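(* Let $G$ be a connected graph of order at least $3$. Then $\gamma_{mt}^{2}(G+K_1)=\gamma_t(G)$.
   Context: All graphs are finite, simple and undirected. $G+K_1$ is the join of $G$ with a single vertex, i.e. $G$ together with a new vertex adjacent to every vertex of $G$. A set $S \subseteq V(X)$ is a total dominating set of a graph $X$ if every vertex of $V(X)$ is adjacent to some vertex of $S$; $\gamma_t(X)$ is the minimum cardinality of a total dominating set of $X$. A non-empty $T\subseteq V(X)$ is a 2-movable total dominating set of a connected graph $X$ if $T$ is a total dominating set and for every pair $x,y\in T$, either $T\setminus\{x,y\}$ is a total dominating set of $X$, or there exist $u,v\in V(X)\setminus T$ such that $u$ is adjacent to $x$, $v$ is adjacent to $y$, and $(T\setminus\{x,y\})\cup\{u,v\}$ is a total dominating set of $X$. $\gamma_{mt}^2(X)$ is the minimum cardinality of a 2-movable total dominating set of $X$. *)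

theory Defs
  imports "Graph_Theory.Graph_Theory"
begin

text \<open>
  A finite simple undirected graph is an instance of the locale \<^locale>\<open>pair_graph\<close>: the edge
  $uv$ is represented by the two arcs \<open>(u, v)\<close> and \<open>(v, u)\<close>.
\<close>

text \<open>The fresh vertex of $G + K_1$ is \<^term>\<open>None\<close>.\<close>

definition join_K1 :: "'a pair_pre_digraph \<Rightarrow> 'a option pair_pre_digraph" where
  "join_K1 G = \<lparr>
     pverts = insert None (Some ` pverts G),
     parcs = {(Some u, Some v) |u v. (u, v) \<in> parcs G}
       \<union> {(None, Some v) |v. v \<in> pverts G}
       \<union> {(Some v, None) |v. v \<in> pverts G} \<rparr>"

definition total_dominating_set :: "'a pair_pre_digraph \<Rightarrow> 'a set \<Rightarrow> bool" where
  "total_dominating_set X S \<longleftrightarrow>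
     S \<subseteq> pverts X \<and> (\<forall>v \<in> pverts X. \<exists>s \<in> S. (v, s) \<in> parcs X)"

text \<open>The vertices \<open>x\<close> and \<open>y\<close> of a pair are distinct, whereas \<open>u\<close> and \<open>v\<close> may coincide.\<close>

definition two_movable_total_dominating_set :: "'a pair_pre_digraph \<Rightarrow> 'a set \<Rightarrow> bool" where
  "two_movable_total_dominating_set X T \<longleftrightarrow>
     T \<noteq> {} \<and> total_dominating_set X T \<and>
     (\<forall>x \<in> T. \<forall>y \<in> T. x \<noteq> y \<longrightarrow>
        total_dominating_set X (T - {x, y}) \<or>
        (\<exists>u \<in> pverts X - T. \<exists>v \<in> pverts X - T.
           (u, x) \<in> parcs X \<and> (v, y) \<in> parcs X \<and>
           total_dominating_set X ((T - {x, y}) \<union> {u, v})))"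

text \<open>
  Both numbers below are meaningful only if a set of the required kind exists; for
  \<open>\<gamma>\<^sub>t\<close> this holds in every connected graph of order at least 2
  (see \<open>total_dominating_set_pverts\<close>).
\<close>

definition total_domination_number :: "'a pair_pre_digraph \<Rightarrow> nat" (\<open>\<gamma>\<^sub>t\<close>) where
  "\<gamma>\<^sub>t X = (LEAST k. \<exists>S. total_dominating_set X S \<and> card S = k)"

definition two_movable_total_domination_number :: "'a pair_pre_digraph \<Rightarrow> nat" (\<open>\<gamma>\<^sub>m\<^sub>t\<^sup>2\<close>) where
  "\<gamma>\<^sub>m\<^sub>t\<^sup>2 X = (LEAST k. \<exists>T. two_movable_total_dominating_set X T \<and> card T = k)"

lemma pair_graph_join_K1:
  assumes "pair_graph G"
  shows "pair_graph (join_K1 G)"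
proof -
  interpret pair_graph G by fact
  have fin: "finite {(Some u, Some v) |u v. (u, v) \<in> parcs G}"
    by (rule finite_subset[of _ "map_prod Some Some ` parcs G"])
       (auto simp: pair_finite_arcs image_iff)
  have symm: "(v, u) \<in> parcs G" if "(u, v) \<in> parcs G" for u v
    using that pair_sym_arcs by (auto simp: symmetric_def sym_def)
  show ?thesis
    by unfold_locales
       (use fin pair_finite_verts in
         \<open>auto simp: join_K1_def symmetric_def sym_def dest: wellformed' no_loops' symm\<close>)
qed

lemma total_dominating_set_pverts:
  assumes "pair_graph G" "Digraph_Component.connected (with_proj G)" "2 \<le> card (pverts G)"
  shows "total_dominating_set G (pverts G)"
proof -
  interpret pair_graph G by fact
  have symm: "(v, u) \<in> parcs G" if "(u, v) \<in> parcs G" for u v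
    using that pair_sym_arcs by (auto simp: symmetric_def sym_def)
  have "\<exists>s \<in> pverts G. (v, s) \<in> parcs G" if v: "v \<in> pverts G" for v
  proof -
    have "\<not> pverts G \<subseteq> {v}"
    proof
      assume "pverts G \<subseteq> {v}"
      then have "card (pverts G) \<le> card {v}" by (intro card_mono) auto
      with assms(3) show False by simp
    qed
    then obtain w where w: "w \<in> pverts G" "w \<noteq> v" by auto
    have "v \<rightarrow>\<^sup>*\<^bsub>mk_symmetric (with_proj G)\<^esub> w"
      using assms(2) v w(1) by (auto simp: connected_def strongly_connected_def)
    then have "(v, w) \<in> (arcs_ends (mk_symmetric (with_proj G)))\<^sup>*"
      by (auto simp: reachable_def dest: rtrancl_on_rtranclI)
    then obtain s where "(v, s) \<in> arcs_ends (mk_symmetric (with_proj G))"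
      using w(2) by (metis converse_rtranclE)
    then have "(v, s) \<in> parcs G"
      by (auto simp: parcs_mk_symmetric intro: symm)
    then show ?thesis by (auto dest: wellformed')
  qed
  then show ?thesis by (auto simp: total_dominating_set_def)
qed

end

theory Submission
  imports Defs
begin

text \<open>
  A total dominating set of \<open>G\<close> is 2-movable in \<open>G + K\<^sub>1\<close>: one of the two removed vertices
  moves to the apex, which dominates all of \<open>G\<close>, so that only a neighbour of the apex has to
  remain. Conversely, a 2-movable set \<open>T\<close> avoiding the apex totally dominates \<open>G\<close>, and if \<open>T\<close>
  contains the apex, then moving the apex together with any other vertex of \<open>T\<close> yields a total
  dominating set of \<open>G\<close> with at most \<open>card T\<close> elements.
\<close>

lemma join_K1_simps [simp]:
  "pverts (join_K1 G) = insert None (Some ` pverts G)"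
  "(Some u, Some v) \<in> parcs (join_K1 G) \<longleftrightarrow> (u, v) \<in> parcs G"
  "(None, Some v) \<in> parcs (join_K1 G) \<longleftrightarrow> v \<in> pverts G"
  "(Some v, None) \<in> parcs (join_K1 G) \<longleftrightarrow> v \<in> pverts G"
  "(None, None) \<notin> parcs (join_K1 G)"
  by (auto simp: join_K1_def)

lemma total_dominating_set_nonempty:
  assumes "total_dominating_set X S" "pverts X \<noteq> {}"
  shows "S \<noteq> {}"
  using assms by (auto simp: total_dominating_set_def)

text \<open>Adjacency inside \<open>G\<close> is unchanged by the join, so only the apex is to be
  checked. Any vertex of \<open>S\<close> dominates it, and \<open>S\<close> is non-empty because a
  vertex of \<open>G\<close> needs a neighbour in \<open>S\<close>.\<close>

lemma total_dominating_set_join_K1_Some: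
  assumes "pverts G \<noteq> {}"
  shows "total_dominating_set (join_K1 G) (Some ` S) \<longleftrightarrow> total_dominating_set G S"
  using assms by (auto simp: total_dominating_set_def) blast

text \<open>The apex dominates every vertex of \<open>G\<close>, and \<open>Some w\<close> dominates
  the apex.\<close>

lemma total_dominating_set_join_K1_apex:
  assumes "T \<subseteq> pverts (join_K1 G)" "None \<in> T" "Some w \<in> T"
  shows "total_dominating_set (join_K1 G) T"
proof -
  have "\<exists>s \<in> T. (v, s) \<in> parcs (join_K1 G)" if "v \<in> pverts (join_K1 G)" for v
    using assms that by (cases v) force+
  then show ?thesis using assms(1) by (simp add: total_dominating_set_def)
qed

lemma two_movable_join_K1_Some:
  assumes G: "pair_graph G" and ord: "3 \<le> card (pverts G)"
    and S: "total_dominating_set G S"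
  shows "two_movable_total_dominating_set (join_K1 G) (Some ` S)"
proof -
  interpret pair_graph G by fact
  have ne: "pverts G \<noteq> {}" using ord by auto
  have sub: "S \<subseteq> pverts G" using S by (simp add: total_dominating_set_def)
  have move: "\<exists>u \<in> pverts (join_K1 G) - Some ` S. \<exists>v \<in> pverts (join_K1 G) - Some ` S.
      (u, Some x) \<in> parcs (join_K1 G) \<and> (v, Some y) \<in> parcs (join_K1 G) \<and>
      total_dominating_set (join_K1 G) ((Some ` S - {Some x, Some y}) \<union> {u, v})"
    if x: "x \<in> S" and y: "y \<in> S" for x y
  proof (cases "S \<subseteq> {x, y}")
    case False
    then obtain w where "w \<in> S" "w \<noteq> x" "w \<noteq> y" by auto
    \<comment> \<open>Both \<open>x\<close> and \<open>y\<close> move to the apex, since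
      \<open>u\<close> and \<open>v\<close> may coincide; the remaining vertex \<open>w\<close>
      dominates the apex.\<close>
    then have "total_dominating_set (join_K1 G) ((Some ` S - {Some x, Some y}) \<union> {None, None})"
      using sub by (intro total_dominating_set_join_K1_apex[where w = w]) auto
    moreover have "None \<in> pverts (join_K1 G) - Some ` S" by auto
    ultimately show ?thesis
      using x y sub by (intro bexI[of _ None]) auto
  next
    case True
    \<comment> \<open>Nothing of \<open>S\<close> survives the removal, so the apex needs a new
      neighbour. Order at least 3 supplies a vertex of \<open>G\<close> outside
      \<open>{x, y}\<close>, hence outside \<open>S\<close>.\<close>
    have "\<not> pverts G \<subseteq> {x, y}"
    proof
      assume "pverts G \<subseteq> {x, y}"
      then have "card (pverts G) \<le> card {x, y}" by (intro card_mono) auto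
      also have "\<dots> \<le> 2" by (simp add: card_insert_if)
      finally show False using ord by simp
    qed
    then obtain w where w: "w \<in> pverts G" "w \<notin> S" using True by auto
    \<comment> \<open>The neighbour of \<open>w\<close> in \<open>S\<close> is \<open>x\<close> or
      \<open>y\<close>: \<open>w\<close> replaces that one, and the apex replaces the other.\<close>
    then obtain s where "s \<in> S" and ws: "(w, s) \<in> parcs G"
      using S by (auto simp: total_dominating_set_def)
    then have "s = x \<or> s = y" using True by auto
    have dom: "total_dominating_set (join_K1 G) ((Some ` S - {Some x, Some y}) \<union> {None, Some w})"
      using sub w by (intro total_dominating_set_join_K1_apex[where w = w]) auto
    have mem: "None \<in> pverts (join_K1 G) - Some ` S" "Some w \<in> pverts (join_K1 G) - Some ` S"
      using w by auto
    from \<open>s = x \<or> s = y\<close> show ?thesis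
    proof
      assume "s = x"
      then show ?thesis
        using mem ws y sub dom
        by (intro bexI[of _ "Some w"] bexI[of _ None]) (auto simp: insert_commute)
    next
      assume "s = y"
      then show ?thesis
        using mem ws x sub dom by (intro bexI[of _ None] bexI[of _ "Some w"]) auto
    qed
  qed
  moreover have "S \<noteq> {}" using total_dominating_set_nonempty[OF S ne] .
  ultimately show ?thesis
    using S total_dominating_set_join_K1_Some[OF ne]
    unfolding two_movable_total_dominating_set_def by blast
qed

lemma total_dominating_set_of_two_movable_join_K1:
  assumes G: "pair_graph G" and ne: "pverts G \<noteq> {}"
    and T: "two_movable_total_dominating_set (join_K1 G) T"
  obtains S where "total_dominating_set G S" "card S \<le> card T"
proof -
  interpret pair_graph G by fact
  have fin: "finite (pverts (join_K1 G))" by (simp add: pair_finite_verts)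
  have dom: "total_dominating_set (join_K1 G) T"
    using T by (simp add: two_movable_total_dominating_set_def)
  then have "finite T" using fin by (auto simp: total_dominating_set_def intro: finite_subset)
  have "\<exists>T'. total_dominating_set (join_K1 G) T' \<and> None \<notin> T' \<and> card T' \<le> card T"
  proof (cases "None \<in> T")
    case False
    with dom show ?thesis by blast
  next
    case True
    \<comment> \<open>The apex has no loop, so its neighbour \<open>y\<close> in \<open>T\<close>
      differs from it and movability applies to this pair.\<close>
    obtain y where y: "y \<in> T" "(None, y) \<in> parcs (join_K1 G)"
      using dom by (auto simp: total_dominating_set_def)
    then have "y \<noteq> None" by (metis join_K1_simps(5))
    let ?R = "T - {None, y}"
    have card: "card ?R + 2 = card T"
      using \<open>finite T\<close> True y(1) \<open>y \<noteq> None\<close>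
        card_mono[of T "{None, y}"] card_Diff_subset[of "{None, y}" T] by auto
    \<comment> \<open>Either resulting set avoids the apex, because \<open>u\<close> and
      \<open>v\<close> lie outside \<open>T\<close>. Two vertices leave and at most two enter, so
      the size does not grow.\<close>
    consider "total_dominating_set (join_K1 G) ?R"
      | u v where "u \<notin> T" "v \<notin> T" "total_dominating_set (join_K1 G) (?R \<union> {u, v})"
      using T True y(1) \<open>y \<noteq> None\<close>
      unfolding two_movable_total_dominating_set_def by blast
    then show ?thesis
    proof cases
      case 1
      then show ?thesis using card by (intro exI[of _ ?R]) auto
    next
      case 2
      have "card (?R \<union> {u, v}) \<le> card ?R + card {u, v}" by (rule card_Un_le)
      also have "\<dots> \<le> card T" using card by (simp add: card_insert_if)
      finally show ?thesis using 2 True by (intro exI[of _ "?R \<union> {u, v}"]) auto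
    qed
  qed
  then obtain T' where T': "total_dominating_set (join_K1 G) T'" "None \<notin> T'" "card T' \<le> card T"
    by blast
  then have "T' = Some ` (Some -` T')"
    by (auto simp: total_dominating_set_def)
  then obtain S where S: "T' = Some ` S" ..
  show thesis
    using that[of S] T' total_dominating_set_join_K1_Some[OF ne, of S]
    by (simp add: S card_image)
qed

theorem theorem3p4:
  fixes G :: "'a pair_pre_digraph"
  assumes "pair_graph G"
    and "Digraph_Component.connected (with_proj G)"
    and "3 \<le> card (pverts G)"
  shows "\<gamma>\<^sub>m\<^sub>t\<^sup>2 (join_K1 G) = \<gamma>\<^sub>t G"
proof (rule antisym)
  \<comment> \<open>Connectedness enters here: all of \<open>pverts G\<close> is totally dominating,
    so the minimum is attained.\<close>
  have "\<exists>k S. total_dominating_set G S \<and> card S = k"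
    using total_dominating_set_pverts[OF assms(1,2)] assms(3) by auto
  then have "\<exists>S. total_dominating_set G S \<and> card S = \<gamma>\<^sub>t G"
    unfolding total_domination_number_def by (rule LeastI_ex)
  then obtain S where S: "total_dominating_set G S" "card S = \<gamma>\<^sub>t G" by blast
  have movable: "two_movable_total_dominating_set (join_K1 G) (Some ` S)"
    by (rule two_movable_join_K1_Some[OF assms(1,3) S(1)])
  moreover have "card (Some ` S) = \<gamma>\<^sub>t G" using S(2) by (simp add: card_image)
  ultimately show "\<gamma>\<^sub>m\<^sub>t\<^sup>2 (join_K1 G) \<le> \<gamma>\<^sub>t G"
    unfolding two_movable_total_domination_number_def by (intro Least_le) blast
  \<comment> \<open>The movable set built from \<open>S\<close> ensures that this minimum is
    attained as well.\<close>
  have "\<exists>T. two_movable_total_dominating_set (join_K1 G) T \<and> card T = \<gamma>\<^sub>m\<^sub>t\<^sup>2 (join_K1 G)"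
    unfolding two_movable_total_domination_number_def by (rule LeastI_ex) (use movable in blast)
  then obtain T where T: "two_movable_total_dominating_set (join_K1 G) T"
    "card T = \<gamma>\<^sub>m\<^sub>t\<^sup>2 (join_K1 G)" by blast
  have "pverts G \<noteq> {}" using assms(3) by auto
  then obtain S' where "total_dominating_set G S'" "card S' \<le> card T"
    using total_dominating_set_of_two_movable_join_K1[OF assms(1) _ T(1)] by blast
  moreover from this have "\<gamma>\<^sub>t G \<le> card S'"
    unfolding total_domination_number_def by (intro Least_le) blast
  ultimately show "\<gamma>\<^sub>t G \<le> \<gamma>\<^sub>m\<^sub>t\<^sup>2 (join_K1 G)" using T(2) by simp
qed

end
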